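(* Let $G$ be an AG-group and let $a,b,c,d\in G$. Then $Par(a,b,c,d)$ holds if and only if there are $x,y\in G$ such that $xb=a$, $by=c$ and $b(xy)=d$.
   Context: An AG-group is a set $G$ with a binary operation (written as juxtaposition, in general neither associative nor commutative) satisfying the left invertive law $(xy)z=(zy)x$ for all $x,y,z\in G$, having a left identity $e$ (so $ex=x$ for all $x\in G$), and such that every $a\in G$ has an inverse $a^{-1}\in G$ with $a^{-1}a=aa^{-1}=e$. For $a,b,c,d\in G$, we say that $a,b,c,d$ form a parallelogram, written $Par(a,b,c,d)$, if there are $p,q\in G$ such that $pa=qb$ and $pd=qc$. *)

theory Defs
  imports "HOL-Algebra.Group"
begin

text \<open>
  The record \<^typ>\<open>('a, 'b) monoid_scheme\<close> is used only as a signature (carrier, operation,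
  distinguished element): neither associativity nor commutativity is assumed, and \<open>\<one>\<close> is
  only required to be a left identity.
\<close>

locale ag_group =
  fixes G (structure)
  assumes m_closed: "\<lbrakk>x \<in> carrier G; y \<in> carrier G\<rbrakk> \<Longrightarrow> x \<otimes> y \<in> carrier G"
    and one_closed: "\<one> \<in> carrier G"
    and left_invertive:
      "\<lbrakk>x \<in> carrier G; y \<in> carrier G; z \<in> carrier G\<rbrakk> \<Longrightarrow> (x \<otimes> y) \<otimes> z = (z \<otimes> y) \<otimes> x"
    and l_one: "x \<in> carrier G \<Longrightarrow> \<one> \<otimes> x = x"
    and inv_ex: "a \<in> carrier G \<Longrightarrow> \<exists>a' \<in> carrier G. a' \<otimes> a = \<one> \<and> a \<otimes> a' = \<one>"

definition Par :: "('a, 'b) monoid_scheme \<Rightarrow> 'a \<Rightarrow> 'a \<Rightarrow> 'a \<Rightarrow> 'a \<Rightarrow> bool" where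
  "Par G a b c d \<longleftrightarrow>
    (\<exists>p \<in> carrier G. \<exists>q \<in> carrier G. p \<otimes>\<^bsub>G\<^esub> a = q \<otimes>\<^bsub>G\<^esub> b \<and> p \<otimes>\<^bsub>G\<^esub> d = q \<otimes>\<^bsub>G\<^esub> c)"

end

theory Submission
  imports Defs
begin

text \<open>
  Since \<open>b(xy) = x(by)\<close>, the right-hand side gives \<open>d = xc\<close> and \<open>a = xb\<close>, so \<open>p = \<one>\<close> and \<open>q = x\<close>
  witness the parallelogram. Conversely \<open>xb = a\<close> and \<open>by = c\<close> are always solvable, and
  \<open>pa = qb\<close> then says that \<open>x(pb) = qb\<close>. This identity does not depend on \<open>b\<close>,
  because \<open>uv = (v\<one>)(u\<one>)\<close>; hence \<open>p(xc) = x(pc) = qc = pd\<close>, and cancelling \<open>p\<close> gives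
  \<open>d = xc = b(xy)\<close>.
\<close>

context ag_group
begin

text \<open>Treat \<open>z \<otimes> w\<close> as one factor: left invertivity brings it next to
  \<open>y\<close>, a second use exchanges \<open>y\<close> and \<open>z\<close>, and a third
  restores the outer order.\<close>

lemma medial:
  assumes "x \<in> carrier G" "y \<in> carrier G" "z \<in> carrier G" "w \<in> carrier G"
  shows "(x \<otimes> y) \<otimes> (z \<otimes> w) = (x \<otimes> z) \<otimes> (y \<otimes> w)"
proof -
  have "(x \<otimes> y) \<otimes> (z \<otimes> w) = ((z \<otimes> w) \<otimes> y) \<otimes> x"
    using left_invertive[of x y "z \<otimes> w"] assms by (simp add: m_closed)
  also have "\<dots> = ((y \<otimes> w) \<otimes> z) \<otimes> x"
    using left_invertive[of z w y] assms by simp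
  also have "\<dots> = (x \<otimes> z) \<otimes> (y \<otimes> w)"
    using left_invertive[of "y \<otimes> w" z x] assms by (simp add: m_closed)
  finally show ?thesis .
qed

lemma left_permutable:
  assumes "x \<in> carrier G" "y \<in> carrier G" "z \<in> carrier G"
  shows "x \<otimes> (y \<otimes> z) = y \<otimes> (x \<otimes> z)"
  using medial[of \<one> x y z] assms by (simp add: one_closed l_one)

text \<open>Right multiplication by \<open>\<one>\<close> is an involution, so \<open>u\<close> can
  be rewritten as \<open>(u \<otimes> \<one>) \<otimes> \<one>\<close>; left invertivity then
  exchanges the outer factors.\<close>

lemma mult_eq_swap_one:
  assumes "u \<in> carrier G" "v \<in> carrier G"
  shows "u \<otimes> v = (v \<otimes> \<one>) \<otimes> (u \<otimes> \<one>)"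
proof -
  have "(u \<otimes> \<one>) \<otimes> \<one> = u"
    using left_invertive[of u \<one> \<one>] assms by (simp add: one_closed l_one)
  then show ?thesis
    using left_invertive[of "u \<otimes> \<one>" \<one> v] assms by (simp add: one_closed m_closed)
qed

text \<open>Without associativity, \<open>u'\<close> itself need not cancel \<open>u\<close> in
  \<open>u \<otimes> v\<close>. Its twist \<open>u' \<otimes> \<one>\<close> does, because the
  medial law pairs \<open>u'\<close> with \<open>u\<close> and \<open>\<one>\<close> with
  \<open>v\<close>.\<close>

lemma left_inverse_mult:
  assumes "u' \<in> carrier G" "u \<in> carrier G" "v \<in> carrier G" "u' \<otimes> u = \<one>"
  shows "(u' \<otimes> \<one>) \<otimes> (u \<otimes> v) = v"
  using medial[of u' \<one> u v] assms by (simp add: one_closed l_one)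

lemma left_cancel:
  assumes "u \<in> carrier G" "v \<in> carrier G" "w \<in> carrier G" "u \<otimes> v = u \<otimes> w"
  shows "v = w"
  using inv_ex[of u] left_inverse_mult assms by metis

lemma left_divisible:
  assumes "b \<in> carrier G" "c \<in> carrier G"
  shows "\<exists>y \<in> carrier G. b \<otimes> y = c"
proof -
  obtain b' where b': "b' \<in> carrier G" "b' \<otimes> b = \<one>"
    using inv_ex assms by blast
  \<comment> \<open>Left permutability moves \<open>b\<close> next to \<open>c\<close>, where the
    twisted inverse cancels it.\<close>
  have "b \<otimes> ((b' \<otimes> \<one>) \<otimes> c) = c"
    using left_permutable[of b "b' \<otimes> \<one>" c] left_inverse_mult[of b' b c] b' assms
    by (simp add: one_closed m_closed)
  then show ?thesis
    using b' assms by (meson one_closed m_closed)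
qed

lemma right_divisible:
  assumes "a \<in> carrier G" "b \<in> carrier G"
  shows "\<exists>x \<in> carrier G. x \<otimes> b = a"
proof -
  obtain b' where b': "b' \<in> carrier G" "b \<otimes> b' = \<one>"
    using inv_ex assms by blast
  \<comment> \<open>Left invertivity swaps \<open>a\<close> and \<open>b\<close>, so here
    \<open>b'\<close> has to be a right inverse of \<open>b\<close>.\<close>
  have "(a \<otimes> b') \<otimes> b = a"
    using left_invertive[of a b' b] b' assms by (simp add: l_one)
  then show ?thesis
    using b' assms by (meson m_closed)
qed

lemma translation_eq:
  assumes "x \<in> carrier G" "p \<in> carrier G" "q \<in> carrier G" "b \<in> carrier G" "c \<in> carrier G"
    and "x \<otimes> (p \<otimes> b) = q \<otimes> b"
  shows "x \<otimes> (p \<otimes> c) = q \<otimes> c"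
proof -
  \<comment> \<open>All dependence on \<open>t\<close> is gathered in the left factor
    \<open>t \<otimes> \<one>\<close>, which can be cancelled for \<open>t = b\<close> and put back
    for \<open>t = c\<close>.\<close>
  have *: "x \<otimes> (p \<otimes> t) = (t \<otimes> \<one>) \<otimes> (x \<otimes> (p \<otimes> \<one>))" if "t \<in> carrier G" for t
    using mult_eq_swap_one[of p t] left_permutable[of x "t \<otimes> \<one>" "p \<otimes> \<one>"] that assms
    by (simp add: one_closed m_closed)
  have "(b \<otimes> \<one>) \<otimes> (x \<otimes> (p \<otimes> \<one>)) = (b \<otimes> \<one>) \<otimes> (q \<otimes> \<one>)"
    using *[of b] mult_eq_swap_one[of q b] assms by simp
  then have "x \<otimes> (p \<otimes> \<one>) = q \<otimes> \<one>"
    by (rule left_cancel[rotated 3]) (use assms in \<open>simp_all add: one_closed m_closed\<close>)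
  then show ?thesis
    using *[of c] mult_eq_swap_one[of q c] assms by simp
qed

end

theorem theorem1:
  fixes G (structure)
  assumes "ag_group G"
    and "a \<in> carrier G" and "b \<in> carrier G" and "c \<in> carrier G" and "d \<in> carrier G"
  shows "Par G a b c d \<longleftrightarrow>
    (\<exists>x \<in> carrier G. \<exists>y \<in> carrier G. x \<otimes> b = a \<and> b \<otimes> y = c \<and> b \<otimes> (x \<otimes> y) = d)"
proof
  interpret ag_group G by fact
  assume "Par G a b c d"
  then obtain p q where pq: "p \<in> carrier G" "q \<in> carrier G" "p \<otimes> a = q \<otimes> b" "p \<otimes> d = q \<otimes> c"
    unfolding Par_def by blast
  obtain x where x: "x \<in> carrier G" "x \<otimes> b = a"
    using right_divisible assms by blast
  obtain y where y: "y \<in> carrier G" "b \<otimes> y = c"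
    using left_divisible assms by blast
  \<comment> \<open>Permuting \<open>x\<close> and \<open>p\<close> makes the left side
    \<open>p \<otimes> (x \<otimes> b)\<close>, that is \<open>p \<otimes> a\<close>.\<close>
  have "x \<otimes> (p \<otimes> b) = q \<otimes> b"
    using left_permutable[of x p b] x pq assms by simp
  then have "x \<otimes> (p \<otimes> c) = q \<otimes> c"
    using translation_eq[of x p q b c] x pq assms by simp
  then have "p \<otimes> (x \<otimes> c) = p \<otimes> d"
    using left_permutable[of x p c] x pq assms by simp
  then have "x \<otimes> c = d"
    using left_cancel[of p "x \<otimes> c" d] x pq assms by (simp add: m_closed)
  then have "b \<otimes> (x \<otimes> y) = d"
    using left_permutable[of b x y] x y assms by simp
  with x y show "\<exists>x \<in> carrier G. \<exists>y \<in> carrier G. x \<otimes> b = a \<and> b \<otimes> y = c \<and> b \<otimes> (x \<otimes> y) = d"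
    by blast
next
  interpret ag_group G by fact
  assume "\<exists>x \<in> carrier G. \<exists>y \<in> carrier G. x \<otimes> b = a \<and> b \<otimes> y = c \<and> b \<otimes> (x \<otimes> y) = d"
  then obtain x y where xy: "x \<in> carrier G" "y \<in> carrier G"
      "x \<otimes> b = a" "b \<otimes> y = c" "b \<otimes> (x \<otimes> y) = d"
    by blast
  have "x \<otimes> c = d"
    using left_permutable[of b x y] xy assms by simp
  then have "\<one> \<otimes> a = x \<otimes> b" "\<one> \<otimes> d = x \<otimes> c"
    using xy assms by (simp_all add: l_one)
  then show "Par G a b c d"
    unfolding Par_def using xy one_closed by blast
qed

end
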